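(* Let $(Q,\cdot)$ be a finite P-groupoid. If $Q$ is left distributive, i.e. $x(yz)=(xy)(xz)$ for all $x,y,z\in Q$, then $Q$ is a distributive quasigroup; that is, $Q$ is a quasigroup and satisfies both $x(yz)=(xy)(xz)$ and $(yz)x=(yx)(zx)$ for all $x,y,z\in Q$.
   Context: A groupoid $(Q,\cdot)$ is a set $Q$ with a binary operation, written as juxtaposition; all groupoids are finite. A groupoid is a P-groupoid if for all $x,y,z\in Q$: (1) $x^2=x$; (2) if $x\neq y$ then $xy\neq x$ and $xy\neq y$; (3) $xy=z$ if and only if $zy=x$. A quasigroup is a groupoid such that for all $a,b\in Q$ the equations $ax=b$ and $ya=b$ have unique solutions $x,y\in Q$. *)

theory Defs
  imports Main
begin

text \<open>
  A groupoid is a carrier set with an operation under which it is closed; the values of the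
  operation outside the carrier are irrelevant. Finiteness of the carrier is not part of the
  definitions below and has to be assumed separately.
\<close>

locale groupoid_on =
  fixes Q :: "'a set" and mult :: "'a \<Rightarrow> 'a \<Rightarrow> 'a" (infixl "\<cdot>" 70)
  assumes closed: "\<lbrakk>x \<in> Q; y \<in> Q\<rbrakk> \<Longrightarrow> x \<cdot> y \<in> Q"

locale P_groupoid_on = groupoid_on +
  assumes idem: "x \<in> Q \<Longrightarrow> x \<cdot> x = x"
    and neq: "\<lbrakk>x \<in> Q; y \<in> Q; x \<noteq> y\<rbrakk> \<Longrightarrow> x \<cdot> y \<noteq> x \<and> x \<cdot> y \<noteq> y"
    and swap: "\<lbrakk>x \<in> Q; y \<in> Q; z \<in> Q\<rbrakk> \<Longrightarrow> x \<cdot> y = z \<longleftrightarrow> z \<cdot> y = x"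

locale quasigroup_on = groupoid_on +
  assumes left_division: "\<lbrakk>a \<in> Q; b \<in> Q\<rbrakk> \<Longrightarrow> \<exists>!x. x \<in> Q \<and> a \<cdot> x = b"
    and right_division: "\<lbrakk>a \<in> Q; b \<in> Q\<rbrakk> \<Longrightarrow> \<exists>!y. y \<in> Q \<and> y \<cdot> a = b"

definition left_distributive_on :: "'a set \<Rightarrow> ('a \<Rightarrow> 'a \<Rightarrow> 'a) \<Rightarrow> bool" where
  "left_distributive_on Q m \<longleftrightarrow>
     (\<forall>x\<in>Q. \<forall>y\<in>Q. \<forall>z\<in>Q. m x (m y z) = m (m x y) (m x z))"

definition right_distributive_on :: "'a set \<Rightarrow> ('a \<Rightarrow> 'a \<Rightarrow> 'a) \<Rightarrow> bool" where
  "right_distributive_on Q m \<longleftrightarrow>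
     (\<forall>x\<in>Q. \<forall>y\<in>Q. \<forall>z\<in>Q. m (m y z) x = m (m y x) (m z x))"

end

theory Submission
  imports Defs
begin

text \<open>
  Axiom \<open>swap\<close> says \<open>(x \<cdot> y) \<cdot> y = x\<close>, so right translations are involutions and right division
  is free; what is missing is that left translations are injective, and right distributivity.

  Let \<open>L\<close> be the left translation by \<open>a\<close>, an endomorphism by left distributivity. On the
  eventual image of \<open>L\<close>, that is, on \<open>e ` Q\<close> for \<open>e = L ^^ n\<close> with \<open>n > 0\<close> large, \<open>L\<close> is onto
  because \<open>Q\<close> is finite. Hence every \<open>b\<close> in \<open>e ` Q\<close> is \<open>a \<cdot> e y\<close> for some \<open>y\<close>, and the right translation
  by \<open>y\<close> injects the fibre of \<open>e\<close> over \<open>b\<close> into the fibre over \<open>b \<cdot> e y = a\<close>. The latter is \<open>{a}\<close>,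
  since axiom \<open>neq\<close> forbids \<open>a \<cdot> x = a\<close> for \<open>x \<noteq> a\<close>. So \<open>e\<close>, and with it \<open>L\<close>, is injective
  (\<open>left_cancel\<close>), and \<open>Q\<close> is a quasigroup.

  For right distributivity, consider the left division, which sends \<open>x\<close> and \<open>y\<close> to the \<open>d\<close> with
  \<open>x \<cdot> d = y\<close>. In the model \<open>x \<cdot> y = 2y - x\<close> this is the midpoint of \<open>x\<close> and \<open>y\<close>. Axiom \<open>swap\<close>
  makes it commutative, and it is preserved by the left translations, which are automorphisms; so
  it is a commutative, idempotent, distributive operation. With any \<open>z\<close> as origin, doubling the
  midpoint yields an addition that makes \<open>Q\<close> a commutative Moufang loop with zero \<open>z\<close>, in which
  the additive inverse of \<open>x\<close> is \<open>x \<cdot> z\<close>. Inversion in such a loop is an automorphism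
  (\<open>inverse_add\<close>); therefore the right translation by \<open>z\<close> preserves midpoints, and hence the
  original operation.
\<close>

section \<open>Inversion in commutative Moufang loops\<close>

text \<open>
  Solvability of equations is stated as cancellation, which amounts to the same on a finite
  carrier. The law is the one that characterizes commutative Moufang loops.
\<close>

locale commutative_moufang_loop_on =
  fixes Q :: "'a set" and add :: "'a \<Rightarrow> 'a \<Rightarrow> 'a" (infixl "\<oplus>" 65) and zero :: 'a ("\<zero>")
  assumes add_closed: "\<lbrakk>x \<in> Q; y \<in> Q\<rbrakk> \<Longrightarrow> x \<oplus> y \<in> Q"
    and zero_closed: "\<zero> \<in> Q"
    and add_commute: "\<lbrakk>x \<in> Q; y \<in> Q\<rbrakk> \<Longrightarrow> x \<oplus> y = y \<oplus> x"
    and add_zero: "x \<in> Q \<Longrightarrow> x \<oplus> \<zero> = x"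
    and add_left_cancel: "\<lbrakk>x \<in> Q; y \<in> Q; w \<in> Q; x \<oplus> y = x \<oplus> w\<rbrakk> \<Longrightarrow> y = w"
    and moufang: "\<lbrakk>x \<in> Q; y \<in> Q; w \<in> Q\<rbrakk> \<Longrightarrow> (x \<oplus> x) \<oplus> (y \<oplus> w) = (x \<oplus> y) \<oplus> (x \<oplus> w)"
begin

lemma left_alternative:
  assumes "x \<in> Q" "y \<in> Q"
  shows "(x \<oplus> x) \<oplus> y = x \<oplus> (x \<oplus> y)"
  using moufang[of x y \<zero>] assms
  by (simp add: add_zero zero_closed add_closed add_commute[of "x \<oplus> y" x])

lemma inverse_property:
  assumes "x \<in> Q" "x' \<in> Q" "y \<in> Q" and inv: "x \<oplus> x' = \<zero>"
  shows "x \<oplus> (x' \<oplus> y) = y"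
proof -
  have "x \<oplus> (x \<oplus> (x' \<oplus> y)) = (x \<oplus> x) \<oplus> (x' \<oplus> y)"
    using assms by (simp add: left_alternative add_closed)
  also have "\<dots> = \<zero> \<oplus> (x \<oplus> y)"
    using assms moufang[of x x' y] by simp
  also have "\<dots> = x \<oplus> y"
    using assms add_commute[of \<zero> "x \<oplus> y"] by (simp add: add_zero zero_closed add_closed)
  finally show ?thesis
    using assms add_left_cancel by (meson add_closed)
qed

text \<open>
  The Moufang law applies once the second summand \<open>x' \<oplus> y'\<close> is also written as \<open>x\<close> plus
  something, which the inverse property does; afterwards it cancels \<open>y\<close> against \<open>y'\<close> inside.
\<close>

lemma inverse_add:
  assumes Q: "x \<in> Q" "x' \<in> Q" "y \<in> Q" "y' \<in> Q"
    and inv: "x \<oplus> x' = \<zero>" "y \<oplus> y' = \<zero>"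
  shows "(x \<oplus> y) \<oplus> (x' \<oplus> y') = \<zero>"
proof -
  define w where "w = x' \<oplus> (x' \<oplus> y')"
  have w: "w \<in> Q"
    using Q by (simp add: w_def add_closed)
  have xw: "x \<oplus> w = x' \<oplus> y'"
    unfolding w_def using Q inv by (simp add: inverse_property add_closed)
  have "w = y' \<oplus> (x' \<oplus> x')"
    unfolding w_def using Q
    by (simp add: left_alternative[symmetric] add_closed add_commute[of y'])
  then have yw: "y \<oplus> w = x' \<oplus> x'"
    using Q inv by (simp add: inverse_property add_closed)
  have "(x \<oplus> y) \<oplus> (x' \<oplus> y') = (x \<oplus> x) \<oplus> (y \<oplus> w)"
    using moufang[of x y w] Q w by (simp add: xw)
  also have "\<dots> = (x \<oplus> x') \<oplus> (x \<oplus> x')"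
    using moufang[of x x' x'] Q by (simp add: yw)
  also have "\<dots> = \<zero>"
    by (simp add: inv add_zero zero_closed)
  finally show ?thesis .
qed

end

section \<open>Injectivity of left translations\<close>

locale finite_left_distributive_P_groupoid = P_groupoid_on +
  assumes finite: "finite Q"
    and left_distributive: "left_distributive_on Q mult"
begin

lemma left_distrib:
  "\<lbrakk>x \<in> Q; y \<in> Q; z \<in> Q\<rbrakk> \<Longrightarrow> x \<cdot> (y \<cdot> z) = (x \<cdot> y) \<cdot> (x \<cdot> z)"
  using left_distributive unfolding left_distributive_on_def by blast

lemma mult_mult_cancel: "\<lbrakk>x \<in> Q; y \<in> Q\<rbrakk> \<Longrightarrow> (x \<cdot> y) \<cdot> y = x"
  using swap[of x y "x \<cdot> y"] closed by blast

lemma power_closed: "\<lbrakk>a \<in> Q; x \<in> Q\<rbrakk> \<Longrightarrow> ((\<cdot>) a ^^ n) x \<in> Q"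
  by (induction n) (simp_all add: closed)

lemma power_mult:
  "\<lbrakk>a \<in> Q; x \<in> Q; y \<in> Q\<rbrakk> \<Longrightarrow> ((\<cdot>) a ^^ n) (x \<cdot> y) = ((\<cdot>) a ^^ n) x \<cdot> ((\<cdot>) a ^^ n) y"
  by (induction n) (simp_all add: left_distrib power_closed)

lemma power_eq_base:
  "\<lbrakk>a \<in> Q; x \<in> Q; ((\<cdot>) a ^^ n) x = a\<rbrakk> \<Longrightarrow> x = a"
  by (induction n) (simp, metis funpow_simps_right(2) neq comp_apply funpow.simps(2) power_closed)

text \<open>
  The images of the iterates of a translation decrease, so an iterate with an image of least
  cardinality has the same image as its successor. The exponent is taken positive so that
  injectivity of the iterate implies injectivity of the translation.
\<close>

lemma eventual_image:
  assumes a: "a \<in> Q"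
  obtains n where "(\<cdot>) a ` (((\<cdot>) a ^^ Suc n) ` Q) = ((\<cdot>) a ^^ Suc n) ` Q"
proof -
  let ?e = "\<lambda>n. (\<cdot>) a ^^ n"
  obtain n where least: "\<And>m. card (?e n ` Q) \<le> card (?e m ` Q)"
    using ex_has_least_nat[of "\<lambda>_. True" 0 "\<lambda>n. card (?e n ` Q)"] by auto
  have step: "(\<cdot>) a ` (?e n ` Q) = ?e (Suc n) ` Q"
    by (simp add: image_comp)
  have "?e (Suc n) ` Q = ?e n ` ((\<cdot>) a ` Q)"
    by (simp only: funpow_Suc_right image_comp)
  also have "\<dots> \<subseteq> ?e n ` Q"
    using a closed by blast
  finally have "?e (Suc n) ` Q = ?e n ` Q"
    using least[of "Suc n"] finite by (intro card_seteq finite_imageI)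
  with step that[of n] show thesis by simp
qed

text \<open>
  A right translation carries any given fibre of a suitable iterate of the left translation into
  the fibre over \<open>a\<close>, and that fibre is a singleton.
\<close>

lemma left_cancel:
  assumes a: "a \<in> Q" and x: "x \<in> Q" and y: "y \<in> Q" and eq: "a \<cdot> x = a \<cdot> y"
  shows "x = y"
proof -
  obtain n where im: "(\<cdot>) a ` (((\<cdot>) a ^^ Suc n) ` Q) = ((\<cdot>) a ^^ Suc n) ` Q"
    using eventual_image[OF a] .
  define e where "e = (\<cdot>) a ^^ Suc n"
  have inj: "u = v" if uv: "u \<in> Q" "v \<in> Q" and e: "e u = e v" for u v
  proof -
    have "e u \<in> (\<cdot>) a ` (e ` Q)"
      using im uv unfolding e_def by blast
    then obtain d where d: "d \<in> Q" "e u = a \<cdot> e d"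
      by blast
    have to_base: "s \<cdot> d = a" if "s \<in> Q" "e s = e u" for s
    proof -
      have "e (s \<cdot> d) = (a \<cdot> e d) \<cdot> e d"
        using that a d by (simp add: e_def power_mult del: funpow.simps)
      also have "\<dots> = a"
        using a d by (simp add: e_def mult_mult_cancel power_closed del: funpow.simps)
      finally show ?thesis
        using power_eq_base[of a "s \<cdot> d" "Suc n"] a d that closed by (simp add: e_def del: funpow.simps)
    qed
    have "u \<cdot> d = v \<cdot> d"
      using to_base[of u] to_base[of v] uv e by simp
    then show ?thesis
      using mult_mult_cancel d uv by metis
  qed
  have "e x = e y"
    unfolding e_def by (simp only: funpow_Suc_right comp_apply eq)
  then show ?thesis
    using inj x y by blast
qed

lemma left_division_unique:
  assumes a: "a \<in> Q" and b: "b \<in> Q"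
  shows "\<exists>!x. x \<in> Q \<and> a \<cdot> x = b"
proof -
  have "inj_on ((\<cdot>) a) Q"
    using left_cancel a by (blast intro: inj_onI)
  moreover have "(\<cdot>) a ` Q \<subseteq> Q"
    using a closed by blast
  ultimately have "(\<cdot>) a ` Q = Q"
    using endo_inj_surj finite by blast
  then show ?thesis
    using left_cancel a b by (metis (no_types, lifting) imageE)
qed

lemma right_division_unique:
  assumes "a \<in> Q" "b \<in> Q"
  shows "\<exists>!y. y \<in> Q \<and> y \<cdot> a = b"
  using assms closed mult_mult_cancel by metis

section \<open>Midpoints and right distributivity\<close>

definition mid :: "'a \<Rightarrow> 'a \<Rightarrow> 'a"  (infixl "\<diamondop>" 70) where
  "x \<diamondop> y = (THE d. d \<in> Q \<and> x \<cdot> d = y)"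

lemma
  assumes "x \<in> Q" "y \<in> Q"
  shows mid_closed: "x \<diamondop> y \<in> Q" and mult_mid: "x \<cdot> (x \<diamondop> y) = y"
  using theI'[OF left_division_unique[OF assms]] unfolding mid_def by auto

lemma mid_eqI: "\<lbrakk>x \<in> Q; d \<in> Q; x \<cdot> d = y\<rbrakk> \<Longrightarrow> x \<diamondop> y = d"
  using left_cancel mid_closed mult_mid closed by metis

lemma mid_commute:
  assumes "x \<in> Q" "y \<in> Q"
  shows "x \<diamondop> y = y \<diamondop> x"
  using assms mid_eqI[of y "x \<diamondop> y" x] swap[of x "x \<diamondop> y" y] by (simp add: mid_closed mult_mid)

lemma mult_mid_distrib:
  assumes "a \<in> Q" "x \<in> Q" "y \<in> Q"
  shows "a \<cdot> (x \<diamondop> y) = (a \<cdot> x) \<diamondop> (a \<cdot> y)"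
  using assms
  by (intro mid_eqI[symmetric]) (simp_all add: closed mid_closed left_distrib[symmetric] mult_mid)

text \<open>Taking midpoints with \<open>x\<close> inverts the left translation by \<open>x\<close>, an automorphism.\<close>

lemma mid_distrib:
  assumes "x \<in> Q" "y \<in> Q" "w \<in> Q"
  shows "x \<diamondop> (y \<diamondop> w) = (x \<diamondop> y) \<diamondop> (x \<diamondop> w)"
proof (rule mid_eqI)
  have "x \<cdot> ((x \<diamondop> y) \<diamondop> (x \<diamondop> w)) = (x \<cdot> (x \<diamondop> y)) \<diamondop> (x \<cdot> (x \<diamondop> w))"
    using assms by (intro mult_mid_distrib mid_closed)
  then show "x \<cdot> ((x \<diamondop> y) \<diamondop> (x \<diamondop> w)) = y \<diamondop> w"
    using assms by (simp add: mult_mid)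
qed (use assms in \<open>simp_all add: mid_closed\<close>)

text \<open>
  The sum of \<open>x\<close> and \<open>y\<close> is twice their midpoint, where doubling is the left translation by the
  origin \<open>z\<close>. Since this translation preserves midpoints, the Moufang law is \<open>mid_distrib\<close>
  scaled by the factor \<open>4\<close>.
\<close>

lemma midpoint_loop:
  assumes z: "z \<in> Q"
  shows "commutative_moufang_loop_on Q (\<lambda>x y. z \<cdot> (x \<diamondop> y)) z"
proof
  fix x y assume "x \<in> Q" "y \<in> Q"
  then show "z \<cdot> (x \<diamondop> y) \<in> Q" "z \<cdot> (x \<diamondop> y) = z \<cdot> (y \<diamondop> x)"
    using z by (simp_all add: closed mid_closed mid_commute)
next
  show "z \<in> Q" by (fact z)
next
  fix x assume "x \<in> Q"
  then show "z \<cdot> (x \<diamondop> z) = x"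
    using z by (simp add: mid_commute[of x z] mult_mid)
next
  fix x y w assume "x \<in> Q" "y \<in> Q" "w \<in> Q" "z \<cdot> (x \<diamondop> y) = z \<cdot> (x \<diamondop> w)"
  then show "y = w"
    using z left_cancel mid_closed mult_mid by metis
next
  fix x y w assume Q: "x \<in> Q" "y \<in> Q" "w \<in> Q"
  have "z \<cdot> (x \<diamondop> x \<diamondop> (y \<diamondop> w)) = z \<cdot> (x \<diamondop> y \<diamondop> (x \<diamondop> w))"
    using Q by (simp add: mid_eqI idem mid_distrib)
  then show "z \<cdot> (z \<cdot> (x \<diamondop> x) \<diamondop> (z \<cdot> (y \<diamondop> w))) = z \<cdot> (z \<cdot> (x \<diamondop> y) \<diamondop> (z \<cdot> (x \<diamondop> w)))"
    using z Q by (simp add: mult_mid_distrib[symmetric] mid_closed)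
qed

lemma mid_mult_distrib:
  assumes Q: "x \<in> Q" "y \<in> Q" "z \<in> Q"
  shows "(x \<diamondop> y) \<cdot> z = (x \<cdot> z) \<diamondop> (y \<cdot> z)"
proof -
  interpret loop: commutative_moufang_loop_on Q "\<lambda>x y. z \<cdot> (x \<diamondop> y)" z
    using Q by (intro midpoint_loop)
  have inv: "z \<cdot> (u \<diamondop> (u \<cdot> z)) = z" if "u \<in> Q" for u
    using that Q by (simp add: mid_eqI idem)
  define m where "m = (x \<diamondop> y) \<diamondop> ((x \<cdot> z) \<diamondop> (y \<cdot> z))"
  have "z \<cdot> (z \<cdot> m) = z"
    using loop.inverse_add[of x "x \<cdot> z" y "y \<cdot> z"] Q inv
    by (simp add: m_def mult_mid_distrib mid_closed closed)
  moreover have "m \<in> Q"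
    using Q by (simp add: m_def mid_closed closed)
  ultimately have "m = z"
    using Q neq closed by metis
  then show ?thesis
    using Q mult_mid[of "x \<diamondop> y" "(x \<cdot> z) \<diamondop> (y \<cdot> z)"] by (simp add: m_def mid_closed closed)
qed

lemma right_distrib:
  assumes Q: "x \<in> Q" "y \<in> Q" "z \<in> Q"
  shows "(x \<cdot> y) \<cdot> z = (x \<cdot> z) \<cdot> (y \<cdot> z)"
proof -
  \<comment> \<open>The element \<open>y\<close> is the midpoint of \<open>x\<close> and \<open>x \<cdot> y\<close>.\<close>
  have "y \<cdot> z = (x \<cdot> z) \<diamondop> ((x \<cdot> y) \<cdot> z)"
    using mid_mult_distrib[of x "x \<cdot> y" z] Q by (simp add: mid_eqI closed)
  then show ?thesis
    using Q by (simp add: mult_mid closed)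
qed

end

theorem theorem2p3:
  fixes Q :: "'a set" and mult :: "'a \<Rightarrow> 'a \<Rightarrow> 'a"
  assumes "finite Q"
    and "P_groupoid_on Q mult"
    and "left_distributive_on Q mult"
  shows "quasigroup_on Q mult \<and> left_distributive_on Q mult \<and> right_distributive_on Q mult"
proof -
  interpret P_groupoid_on Q mult by fact
  interpret finite_left_distributive_P_groupoid Q mult
    using assms by unfold_locales
  have "quasigroup_on Q mult"
    by unfold_locales (fact left_division_unique right_division_unique)+
  moreover have "right_distributive_on Q mult"
    unfolding right_distributive_on_def using right_distrib by blast
  ultimately show ?thesis
    using assms by blast
qed

end
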